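(* For every positive integer $k$, there exist at least $2^k$ pairwise non-isomorphic graphs which all have the same resistance spectrum.
   Context: All graphs are finite, simple and undirected. The resistance distance $R_G(x,y)$ between two vertices $x,y$ of a graph $G$ is the effective resistance between $x$ and $y$ in the electrical network obtained from $G$ by replacing each edge by a unit resistor; by convention $R_G(x,y)=+\infty$ if $x$ and $y$ lie in different connected components of $G$. The resistance spectrum $\mathrm{RS}(G)$ of $G$ is the multiset of the resistance distances $R_G(x,y)$ over all unordered pairs $\{x,y\}$ of distinct vertices of $G$. *)

theory Defs
  imports
    "Graph_Theory.Graph_Theory"
    "HOL-Library.Extended_Real"
    "HOL-Library.Multiset"
begin

text \<open>
  A finite simple undirected graph is an element of the locale \<^locale>\<open>pair_graph\<close>: a finite loopless
  symmetric digraph whose arcs are pairs of vertices. An undirected edge is thus a pair of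
  opposite arcs \<open>(u, w)\<close>, \<open>(w, u)\<close>, which together stand for one unit resistor.
\<close>

text \<open>
  By Ohm's law \<open>p u - p w\<close> is the current from \<open>u\<close> to \<open>w\<close> through the unit resistor on that edge. By
  Kirchhoff's current law, when one unit of current enters the network at \<open>x\<close> and leaves it at \<open>y\<close>,
  the net current flowing from \<open>u\<close> to its neighbours is the current injected at \<open>u\<close>.
\<close>

definition unit_current_potential ::
    "'a pair_pre_digraph \<Rightarrow> 'a \<Rightarrow> 'a \<Rightarrow> ('a \<Rightarrow> real) \<Rightarrow> bool" where
  "unit_current_potential G x y p \<longleftrightarrow>
     (\<forall>u\<in>pverts G. (\<Sum>w | (u, w) \<in> parcs G. p u - p w) = of_bool (u = x) - of_bool (u = y))"

definition resistance_distance :: "'a pair_pre_digraph \<Rightarrow> 'a \<Rightarrow> 'a \<Rightarrow> ereal" where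
  "resistance_distance G x y =
     (if x \<rightarrow>\<^sup>*\<^bsub>with_proj G\<^esub> y
      then ereal (THE r. \<exists>p. unit_current_potential G x y p \<and> r = p x - p y)
      else \<infinity>)"

text \<open>
  The inner description lifts the resistance distance to unordered pairs; it is well-defined
  by symmetry.
\<close>

definition resistance_spectrum :: "'a pair_pre_digraph \<Rightarrow> ereal multiset" where
  "resistance_spectrum G =
     image_mset (\<lambda>e. THE r. \<exists>x y. e = {x, y} \<and> r = resistance_distance G x y)
       (mset_set {e. e \<subseteq> pverts G \<and> card e = 2})"

lemma unit_current_potential_unique:
  assumes G: "pair_graph G" and xy: "x \<rightarrow>\<^sup>*\<^bsub>with_proj G\<^esub> y"
    and p: "unit_current_potential G x y p" and q: "unit_current_potential G x y q"
  shows "p x - p y = q x - q y"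
proof -
  interpret pair_graph G by fact
  define d where "d u = p u - q u" for u
  have d0: "(\<Sum>w | (u, w) \<in> parcs G. d u - d w) = 0" if "u \<in> pverts G" for u
  proof -
    have "(\<Sum>w | (u, w) \<in> parcs G. d u - d w) =
        (\<Sum>w | (u, w) \<in> parcs G. p u - p w) - (\<Sum>w | (u, w) \<in> parcs G. q u - q w)"
      by (simp add: d_def sum_subtractf[symmetric] algebra_simps)
    then show ?thesis
      using p q that by (simp add: unit_current_potential_def)
  qed
  have fin: "finite {w. (u, w) \<in> parcs G}" for u
    using finite_imageI[OF pair_finite_arcs, of snd] by (rule rev_finite_subset) force
  have "(\<Sum>(u, w)\<in>parcs G. d u * (d u - d w)) =
      (\<Sum>(u, w)\<in>(SIGMA u:pverts G. {w. (u, w) \<in> parcs G}). d u * (d u - d w))"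
    by (rule sum.cong) (auto dest: in_arcsD1)
  also have "\<dots> = (\<Sum>u\<in>pverts G. \<Sum>w | (u, w) \<in> parcs G. d u * (d u - d w))"
    using pair_finite_verts fin by (subst sum.Sigma) auto
  also have "\<dots> = (\<Sum>u\<in>pverts G. d u * (\<Sum>w | (u, w) \<in> parcs G. d u - d w))"
    by (simp add: sum_distrib_left)
  also have "\<dots> = 0"
    using d0 by simp
  finally have 1: "(\<Sum>(u, w)\<in>parcs G. d u * (d u - d w)) = 0" .
  have sym: "(w, u) \<in> parcs G" if "(u, w) \<in> parcs G" for u w
    using pair_sym_arcs that by (auto simp: symmetric_def sym_def)
  have "(\<Sum>(u, w)\<in>parcs G. d w * (d w - d u)) = (\<Sum>(u, w)\<in>parcs G. d u * (d u - d w))"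
    by (rule sum.reindex_bij_witness[of _ prod.swap prod.swap]) (auto dest: sym)
  with 1 have "(\<Sum>(u, w)\<in>parcs G. d u * (d u - d w)) + (\<Sum>(u, w)\<in>parcs G. d w * (d w - d u)) = 0"
    by simp
  then have "(\<Sum>(u, w)\<in>parcs G. (d u - d w)\<^sup>2) = 0"
    by (simp add: sum.distrib[symmetric] case_prod_unfold power2_eq_square algebra_simps)
  then have arc: "d u = d w" if "(u, w) \<in> parcs G" for u w
    using that pair_finite_arcs by (subst (asm) sum_nonneg_eq_0_iff) auto
  have "(x, y) \<in> (parcs G)\<^sup>*"
    using reachable_rtranclI[OF xy] by simp
  then have "d x = d y"
    by induction (auto dest: arc)
  then show ?thesis
    by (simp add: d_def)
qed

lemma resistance_distance_eqI:
  assumes "pair_graph G" "x \<rightarrow>\<^sup>*\<^bsub>with_proj G\<^esub> y" "unit_current_potential G x y p"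
  shows "resistance_distance G x y = ereal (p x - p y)"
proof -
  have "(THE r. \<exists>p. unit_current_potential G x y p \<and> r = p x - p y) = p x - p y"
    using assms(3) unit_current_potential_unique[OF assms(1,2) _ assms(3)] by blast
  then show ?thesis
    using assms(2) by (simp add: resistance_distance_def)
qed

lemma unit_current_potential_swap:
  assumes "unit_current_potential G x y p"
  shows "unit_current_potential G y x (\<lambda>u. - p u)"
proof -
  have "(\<Sum>w | (u, w) \<in> parcs G. - p u - - p w) = - (\<Sum>w | (u, w) \<in> parcs G. p u - p w)" for u
    by (simp add: sum_negf[symmetric])
  then show ?thesis
    using assms by (simp add: unit_current_potential_def)
qed

lemma resistance_distance_sym:
  assumes "pair_graph G"
  shows "resistance_distance G x y = resistance_distance G y x"
proof -
  interpret pair_graph G by fact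
  have "x \<rightarrow>\<^sup>*\<^bsub>with_proj G\<^esub> y \<longleftrightarrow> y \<rightarrow>\<^sup>*\<^bsub>with_proj G\<^esub> x"
    using symmetric_reachable[OF pair_sym_arcs] by blast
  moreover have *: "\<exists>p. unit_current_potential G y x p \<and> r = p y - p x"
    if "\<exists>p. unit_current_potential G x y p \<and> r = p x - p y" for x y r
    using that unit_current_potential_swap by fastforce
  have "(\<exists>p. unit_current_potential G x y p \<and> r = p x - p y) \<longleftrightarrow>
      (\<exists>p. unit_current_potential G y x p \<and> r = p y - p x)" for r
    using *[of x y r] *[of y x r] by blast
  ultimately show ?thesis
    by (simp add: resistance_distance_def)
qed

lemma resistance_distance_unordered:
  assumes "pair_graph G"
  shows "(THE r. \<exists>a b. {x, y} = {a, b} \<and> r = resistance_distance G a b) = resistance_distance G x y"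
proof (rule the_equality)
  fix r assume "\<exists>a b. {x, y} = {a, b} \<and> r = resistance_distance G a b"
  then show "r = resistance_distance G x y"
    using resistance_distance_sym[OF assms, of x y] by (metis doubleton_eq_iff)
qed blast

end

theory Submission
  imports Defs
begin

text \<open>
  The graphs are disjoint unions of stars. In such a graph a centre and one of its leaves are at
  resistance distance \<open>1\<close>, two leaves of one star at distance \<open>2\<close>, and vertices of different stars at
  distance \<open>\<infinity>\<close>. So the resistance spectrum depends only on three numbers: of vertices, of leaves,
  and of pairs of leaves with a common centre (\<open>resistance_spectrum_forest\<close>).

  For stars with \<open>a\<^sub>1, \<dots>, a\<^sub>s\<close> leaves, these numbers are determined by \<open>s\<close>, \<open>\<Sum>a\<^sub>j\<close> and \<open>\<Sum>a\<^sub>j\<^sup>2\<close>, and they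
  do not determine the \<open>a\<^sub>j\<close>: as \<open>3 + 3 + 0 = 4 + 1 + 1\<close> and \<open>9 + 9 + 0 = 16 + 1 + 1\<close>, the stars with
  \<open>3, 3, 0\<close> leaves and those with \<open>4, 1, 1\<close> leaves form two blocks of nine vertices with the same
  resistance spectrum. The union of \<open>i\<close> blocks of the first kind and \<open>m - i\<close> blocks of the second kind
  then has a spectrum independent of \<open>i\<close>, but it has exactly \<open>i\<close> isolated vertices. Therefore these
  unions for \<open>i = 0, \<dots>, m\<close> are pairwise non-isomorphic, and \<open>m = 2 ^ k\<close> gives more than enough of them.
\<close>

section \<open>Resistance in star forests\<close>

text \<open>
  A partition into stars is encoded by the idempotent map that sends each vertex to the centre of its
  star. Its fixed points are the centres; a star may consist of its centre alone. The order on the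
  vertices serves only to list each unordered pair of leaves once.
\<close>

locale star_forest =
  fixes V :: "'a :: linorder set" and c :: "'a \<Rightarrow> 'a"
  assumes finite_V: "finite V"
    and centre_in_V: "v \<in> V \<Longrightarrow> c v \<in> V"
    and centre_idem: "v \<in> V \<Longrightarrow> c (c v) = c v"
begin

definition forest :: "'a pair_pre_digraph" where
  "forest = \<lparr>pverts = V, parcs = {(u, w). u \<in> V \<and> w \<in> V \<and> u \<noteq> w \<and> (c u = w \<or> c w = u)}\<rparr>"

definition leaves :: "'a set" where
  "leaves = {v \<in> V. c v \<noteq> v}"

definition leaf_pairs :: "('a \<times> 'a) set" where
  "leaf_pairs = {(x, y). x \<in> leaves \<and> y \<in> leaves \<and> x < y \<and> c x = c y}"

lemma pverts_forest [simp]: "pverts forest = V"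
  by (simp add: forest_def)

lemma mem_parcs_forest:
  "(u, w) \<in> parcs forest \<longleftrightarrow> u \<in> V \<and> w \<in> V \<and> u \<noteq> w \<and> (c u = w \<or> c w = u)"
  by (simp add: forest_def)

lemma pair_graph_forest: "pair_graph forest"
proof
  show "finite (parcs forest)"
    by (rule finite_subset[of _ "V \<times> V"]) (auto simp: forest_def finite_V)
  show "symmetric (with_proj forest)"
    by (auto simp: symmetric_def sym_def mem_parcs_forest)
qed (auto simp: forest_def finite_V)

text \<open>The centre map is constant along edges, so its fibres contain the components.\<close>

lemma same_centre_if_reachable:
  assumes "x \<rightarrow>\<^sup>*\<^bsub>with_proj forest\<^esub> y"
  shows "c x = c y"
proof -
  interpret pair_graph forest by (rule pair_graph_forest)
  have "(x, y) \<in> (parcs forest)\<^sup>*"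
    using reachable_rtranclI[OF assms] by simp
  then show ?thesis
    by induction (auto simp: mem_parcs_forest dest: centre_idem)
qed

lemma reachable_if_same_centre:
  assumes "x \<in> V" "y \<in> V" "c x = c y"
  shows "x \<rightarrow>\<^sup>*\<^bsub>with_proj forest\<^esub> y"
proof -
  interpret pair_graph forest by (rule pair_graph_forest)
  have to_centre: "v \<rightarrow>\<^sup>*\<^bsub>with_proj forest\<^esub> c v" if "v \<in> V" for v
  proof (cases "c v = v")
    case True
    then show ?thesis
      using that by (simp add: reachable_refl)
  next
    case False
    then have "(v, c v) \<in> parcs forest"
      using that centre_in_V by (auto simp: mem_parcs_forest)
    then show ?thesis
      by (intro reachable_adjI) simp
  qed
  have "c y \<rightarrow>\<^sup>*\<^bsub>with_proj forest\<^esub> y"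
    using to_centre[OF assms(2)] symmetric_reachable[OF pair_sym_arcs] by blast
  then show ?thesis
    using to_centre[OF assms(1)] assms(3) by (metis reachable_trans)
qed

text \<open>
  Raising the potential of one leaf by a unit drives a unit current from that leaf to its centre and
  no current elsewhere. Every flow needed below is a difference of two such flows.
\<close>

lemma outflow_leaf_indicator:
  assumes "x \<in> leaves" "u \<in> V"
  shows "(\<Sum>w | (u, w) \<in> parcs forest. of_bool (u = x) - of_bool (w = x) :: real) =
    of_bool (u = x) - of_bool (u = c x)"
proof -
  have fin: "finite {w. (u, w) \<in> parcs forest}"
    by (rule finite_subset[OF _ finite_V]) (auto simp: mem_parcs_forest)
  consider "u = x" | "u = c x" "u \<noteq> x" | "u \<noteq> x" "u \<noteq> c x" by blast
  then show ?thesis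
  proof cases
    case 1
    have "{w. (x, w) \<in> parcs forest} = {c x}"
      using assms(1) by (auto simp: leaves_def mem_parcs_forest centre_in_V dest: centre_idem)
    then show ?thesis
      using 1 assms(1) by (auto simp: leaves_def)
  next
    case 2
    have "x \<in> {w. (u, w) \<in> parcs forest}"
      using 2 assms by (auto simp: leaves_def mem_parcs_forest)
    then show ?thesis
      using 2 fin by (simp add: sum_negf of_bool_def)
  next
    case 3
    have "x \<notin> {w. (u, w) \<in> parcs forest}"
      using 3 assms centre_idem by (auto simp: leaves_def mem_parcs_forest)
    then have "(\<Sum>w | (u, w) \<in> parcs forest. of_bool (u = x) - of_bool (w = x) :: real) = 0"
      using 3 by (intro sum.neutral) auto
    then show ?thesis
      using 3 by simp
  qed
qed

text \<open>
  A unit current from \<open>x\<close> to \<open>y\<close> is the flow from \<open>x\<close> to the common centre minus the flow from \<open>y\<close> to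
  it, where a flow from the centre to itself is zero. Each endpoint that is a leaf contributes one
  unit resistor.
\<close>

lemma resistance_same_star:
  assumes x: "x \<in> V" and y: "y \<in> V" and xy: "x \<noteq> y" and same: "c x = c y"
  shows "resistance_distance forest x y = of_bool (x \<in> leaves) + of_bool (y \<in> leaves)"
proof -
  \<comment> \<open>\<open>\<phi> v\<close> drives a unit current from \<open>v\<close> to its centre; it vanishes if \<open>v\<close> is the centre.\<close>
  define \<phi> where "\<phi> v u = (of_bool (v \<in> leaves \<and> u = v) :: real)" for v u
  define p where "p u = \<phi> x u - \<phi> y u" for u
  have \<phi>: "(\<Sum>w | (u, w) \<in> parcs forest. \<phi> v u - \<phi> v w) = of_bool (u = v) - of_bool (u = c v)"
    if "u \<in> V" "v \<in> V" for u v
    using that outflow_leaf_indicator[of v u] by (cases "v \<in> leaves") (auto simp: \<phi>_def leaves_def)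
  have "(\<Sum>w | (u, w) \<in> parcs forest. p u - p w) = of_bool (u = x) - of_bool (u = y)"
    if "u \<in> V" for u
  proof -
    have "(\<Sum>w | (u, w) \<in> parcs forest. p u - p w) =
        (\<Sum>w | (u, w) \<in> parcs forest. \<phi> x u - \<phi> x w) -
        (\<Sum>w | (u, w) \<in> parcs forest. \<phi> y u - \<phi> y w)"
      by (simp add: p_def sum_subtractf[symmetric] algebra_simps)
    then show ?thesis
      using \<phi> that x y same by simp
  qed
  then have "unit_current_potential forest x y p"
    by (simp add: unit_current_potential_def)
  then have "resistance_distance forest x y = ereal (p x - p y)"
    using pair_graph_forest reachable_if_same_centre[OF x y same] by (intro resistance_distance_eqI)
  then show ?thesis
    using xy by (simp add: p_def \<phi>_def)
qed

lemma resistance_different_stars: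
  assumes "c x \<noteq> c y"
  shows "resistance_distance forest x y = \<infinity>"
  using assms same_centre_if_reachable by (auto simp: resistance_distance_def)

text \<open>
  The two-element vertex sets split into the pairs of a leaf and its centre, the pairs of leaves with a
  common centre, and the pairs meeting two stars; the resistance is constant on each class.
\<close>

lemma resistance_spectrum_forest:
  "resistance_spectrum forest =
     replicate_mset (card leaves) 1 + replicate_mset (card leaf_pairs) 2 +
     replicate_mset ((card V choose 2) - (card leaves + card leaf_pairs)) \<infinity>"
proof -
  define R where "R e = (THE r. \<exists>x y. e = {x, y} \<and> r = resistance_distance forest x y)" for e
  have R: "R {x, y} = resistance_distance forest x y" for x y
    unfolding R_def by (rule resistance_distance_unordered[OF pair_graph_forest])
  define E where "E = {e. e \<subseteq> V \<and> card e = 2}"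
  define E1 where "E1 = (\<lambda>x. {x, c x}) ` leaves"
  define E2 where "E2 = (\<lambda>(x, y). {x, y}) ` leaf_pairs"
  have finE: "finite E"
    unfolding E_def using finite_V by simp
  have leaves: "x \<in> V" "c x \<in> V" "c x \<noteq> x" "c (c x) = c x" "c x \<notin> leaves" if "x \<in> leaves" for x
    using that centre_in_V centre_idem by (auto simp: leaves_def)
  have sub: "E1 \<subseteq> E" "E2 \<subseteq> E"
    using leaves by (force simp: E_def E1_def E2_def leaf_pairs_def card_insert_if)+
  have disj: "E1 \<inter> E2 = {}"
    using leaves by (auto simp: E1_def E2_def leaf_pairs_def doubleton_eq_iff)
  have fin: "finite E1" "finite E2"
    using sub finE finite_subset by auto
  have "inj_on (\<lambda>x. {x, c x}) leaves"
    using leaves by (auto simp: inj_on_def doubleton_eq_iff)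
  then have card1: "card E1 = card leaves"
    unfolding E1_def by (rule card_image)
  have "inj_on (\<lambda>(x, y). {x, y}) leaf_pairs"
    by (auto simp: inj_on_def leaf_pairs_def doubleton_eq_iff)
  then have card2: "card E2 = card leaf_pairs"
    unfolding E2_def by (rule card_image)
  have card3: "card (E - (E1 \<union> E2)) = (card V choose 2) - (card leaves + card leaf_pairs)"
    using card_Diff_subset[of "E1 \<union> E2" E] card_Un_disjoint[OF fin disj] fin sub
      n_subsets[OF finite_V, of 2] card1 card2 by (simp add: E_def)
  have R1: "R e = 1" if eE1: "e \<in> E1" for e
  proof -
    obtain x where e: "e = {x, c x}" and x: "x \<in> leaves"
      using eE1 by (auto simp: E1_def)
    show ?thesis
      unfolding e R using leaves[OF x] x by (subst resistance_same_star) auto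
  qed
  have R2: "R e = 2" if eE2: "e \<in> E2" for e
  proof -
    obtain x y where e: "e = {x, y}" and xy: "x \<in> leaves" "y \<in> leaves" "x < y" "c x = c y"
      using eE2 by (auto simp: E2_def leaf_pairs_def)
    show ?thesis
      unfolding e R using leaves(1) xy by (subst resistance_same_star) auto
  qed
  have R3: "R e = \<infinity>" if e: "e \<in> E - (E1 \<union> E2)" for e
  proof -
    obtain x y where xy: "e = {x, y}" "x < y" "x \<in> V" "y \<in> V"
    proof -
      obtain x y where "e = {x, y}" "x \<noteq> y" "x \<in> V" "y \<in> V"
        using e by (auto simp: E_def card_2_iff)
      then show thesis
        using that[of x y] that[of y x] by (cases "x < y") (auto simp: insert_commute)
    qed
    have "c x \<noteq> c y"
    proof
      assume same: "c x = c y"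
      have "(x, y) \<notin> leaf_pairs" "\<not> (x \<in> leaves \<and> y = c x)" "\<not> (y \<in> leaves \<and> x = c y)"
        using e xy(1) by (auto simp: E1_def E2_def insert_commute)
      then show False
        using same xy by (auto simp: leaf_pairs_def leaves_def)
    qed
    then show ?thesis
      unfolding xy(1) R by (rule resistance_different_stars)
  qed
  have const: "image_mset R (mset_set A) = replicate_mset (card A) r"
    if "\<And>e. e \<in> A \<Longrightarrow> R e = r" "finite A" for A r
  proof -
    have "image_mset R (mset_set A) = image_mset (\<lambda>_. r) (mset_set A)"
      using that by (intro image_mset_cong) auto
    then show ?thesis
      by (simp add: image_mset_const_eq)
  qed
  have "E = (E1 \<union> E2) \<union> (E - (E1 \<union> E2))"
    using sub by blast
  then have "mset_set E = mset_set ((E1 \<union> E2) \<union> (E - (E1 \<union> E2)))"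
    by (rule arg_cong)
  also have "\<dots> = mset_set E1 + mset_set E2 + mset_set (E - (E1 \<union> E2))"
    using fin finE disj by (subst mset_set_Union; simp add: mset_set_Union)
  finally have "image_mset R (mset_set E) =
      replicate_mset (card E1) 1 + replicate_mset (card E2) 2 +
      replicate_mset (card (E - (E1 \<union> E2))) \<infinity>"
    using const[of E1 1] const[of E2 2] const[of "E - (E1 \<union> E2)" \<infinity>] R1 R2 R3 fin finE by simp
  then show ?thesis
    by (simp only: card1 card2 card3) (simp add: resistance_spectrum_def R_def[abs_def] E_def)
qed

end

section \<open>Two kinds of blocks of three stars\<close>

text \<open>
  The centre maps of the stars with \<open>3, 3, 0\<close> leaves and with \<open>4, 1, 1\<close> leaves on \<open>{0..<9}\<close>: entry \<open>r\<close> is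
  the centre of the star containing \<open>r\<close>. A centre with leaves is directly followed by one of them.
\<close>

definition block_pattern :: "bool \<Rightarrow> nat list" where
  "block_pattern b = (if b then [0, 0, 0, 0, 4, 4, 4, 4, 8] else [0, 0, 0, 0, 0, 5, 5, 7, 7])"

text \<open>
  Vertex \<open>9 * q + r\<close> is vertex \<open>r\<close> of block \<open>q\<close>, and the first \<open>i\<close> blocks are those of the first kind.
\<close>

definition block_centre :: "nat \<Rightarrow> nat \<Rightarrow> nat" where
  "block_centre i v = 9 * (v div 9) + block_pattern (v div 9 < i) ! (v mod 9)"

lemma all_less_9: "(\<forall>r<9. P r) \<longleftrightarrow> P 0 \<and> P 1 \<and> P 2 \<and> P 3 \<and> P 4 \<and> P 5 \<and> P 6 \<and> P 7 \<and> P (8::nat)"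
  by (simp add: numeral_eq_Suc All_less_Suc conj_ac)

lemma block_pattern_less: "r < 9 \<Longrightarrow> block_pattern b ! r < 9"
proof -
  have "\<forall>r<9. block_pattern b ! r < 9"
    unfolding all_less_9 by (simp add: block_pattern_def)
  then show "r < 9 \<Longrightarrow> block_pattern b ! r < 9" by blast
qed

lemma block_pattern_idem: "r < 9 \<Longrightarrow> block_pattern b ! (block_pattern b ! r) = block_pattern b ! r"
proof -
  have "\<forall>r<9. block_pattern b ! (block_pattern b ! r) = block_pattern b ! r"
    unfolding all_less_9 by (simp add: block_pattern_def)
  then show "r < 9 \<Longrightarrow> block_pattern b ! (block_pattern b ! r) = block_pattern b ! r" by blast
qed

lemma block_centre_div [simp]: "block_centre i v div 9 = v div 9"
  and block_centre_mod [simp]: "block_centre i v mod 9 = block_pattern (v div 9 < i) ! (v mod 9)"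
  using block_pattern_less[of "v mod 9"] by (auto simp: block_centre_def)

lemma block_centre_eq_iff:
  "block_centre i x = y \<longleftrightarrow>
    x div 9 = y div 9 \<and> block_pattern (x div 9 < i) ! (x mod 9) = y mod 9"
  by (metis block_centre_div block_centre_mod div_mult_mod_eq)

interpretation block: star_forest "{..<9 * m}" "block_centre i" for m i
proof
  fix v assume "v \<in> {..<9 * m}"
  then show "block_centre i v \<in> {..<9 * m}"
    using block_centre_div[of i v] by (simp add: div_less_iff_less_mult[symmetric] mult.commute)
  show "block_centre i (block_centre i v) = block_centre i v"
    by (simp add: block_centre_eq_iff block_pattern_idem)
qed simp

text \<open>
  The leaves and leaf pairs of one block as lists, so that they can be counted by evaluation.
\<close>

definition pattern_leaves :: "bool \<Rightarrow> nat list" where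
  "pattern_leaves b = filter (\<lambda>r. block_pattern b ! r \<noteq> r) [0..<9]"

definition pattern_leaf_pairs :: "bool \<Rightarrow> (nat \<times> nat) list" where
  "pattern_leaf_pairs b =
     filter (\<lambda>(r, s). r < s \<and> block_pattern b ! r = block_pattern b ! s)
       (List.product (pattern_leaves b) (pattern_leaves b))"

lemma card_pattern_leaves: "card (set (pattern_leaves b)) = 6"
proof -
  have "length (pattern_leaves True) = 6" "length (pattern_leaves False) = 6"
    by code_simp+
  moreover have "distinct (pattern_leaves b)"
    by (simp add: pattern_leaves_def)
  ultimately show ?thesis
    by (cases b) (simp_all add: distinct_card)
qed

lemma card_pattern_leaf_pairs: "card (set (pattern_leaf_pairs b)) = 6"
proof -
  have "length (pattern_leaf_pairs True) = 6" "length (pattern_leaf_pairs False) = 6"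
    by code_simp+
  moreover have "distinct (pattern_leaf_pairs b)"
    by (simp add: pattern_leaf_pairs_def pattern_leaves_def distinct_product)
  ultimately show ?thesis
    by (cases b) (simp_all add: distinct_card)
qed

text \<open>
  Both kinds of blocks have six leaves and six leaf pairs (\<open>3 + 3 + 0\<close> and \<open>6 + 0 + 0\<close> by stars), and
  no star meets two blocks. So the counts over all blocks do not depend on \<open>i\<close>.
\<close>

lemma card_leaves_block: "card (block.leaves m i) = 6 * m"
proof -
  have "bij_betw (\<lambda>v. (v div 9, v mod 9)) (block.leaves m i)
      (SIGMA q:{..<m}. set (pattern_leaves (q < i)))"
    by (rule bij_betw_byWitness[where f' = "\<lambda>(q, r). 9 * q + r"])
      (auto simp: block.leaves_def pattern_leaves_def block_centre_eq_iff)
  then show ?thesis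
    using card_pattern_leaves by (simp add: bij_betw_same_card)
qed

lemma card_leaf_pairs_block: "card (block.leaf_pairs m i) = 6 * m"
proof -
  have "bij_betw (\<lambda>(x, y). (x div 9, x mod 9, y mod 9)) (block.leaf_pairs m i)
      (SIGMA q:{..<m}. set (pattern_leaf_pairs (q < i)))"
  proof (rule bij_betw_byWitness[where f' = "\<lambda>(q, r, s). (9 * q + r, 9 * q + s)"])
    have same_block: "x div 9 = y div 9 \<and> (x < y \<longleftrightarrow> x mod 9 < y mod 9)"
      if "block_centre i x = block_centre i y" for x y
      using that by (metis block_centre_div add_less_cancel_left mult_div_mod_eq)
    show "\<forall>a\<in>block.leaf_pairs m i.
        (\<lambda>(q, r, s). (9 * q + r, 9 * q + s)) ((\<lambda>(x, y). (x div 9, x mod 9, y mod 9)) a) = a"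
      by (auto simp: block.leaf_pairs_def dest!: same_block)
    show "(\<lambda>(x, y). (x div 9, x mod 9, y mod 9)) ` block.leaf_pairs m i
        \<subseteq> (SIGMA q:{..<m}. set (pattern_leaf_pairs (q < i)))"
    proof (rule image_subsetI)
      fix t assume "t \<in> block.leaf_pairs m i"
      then obtain x y where t: "t = (x, y)" and xy: "(x, y) \<in> block.leaf_pairs m i"
        by (cases t) simp
      then have "block_centre i x = block_centre i y"
        by (simp add: block.leaf_pairs_def)
      with xy same_block[OF this] show "(\<lambda>(x, y). (x div 9, x mod 9, y mod 9)) t \<in>
          (SIGMA q:{..<m}. set (pattern_leaf_pairs (q < i)))"
        unfolding t
        by (auto simp: block.leaf_pairs_def block.leaves_def pattern_leaf_pairs_def
          pattern_leaves_def block_centre_eq_iff div_less_iff_less_mult)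
    qed
  qed (auto simp: block.leaf_pairs_def block.leaves_def pattern_leaf_pairs_def pattern_leaves_def
      block_centre_eq_iff)
  then show ?thesis
    using card_pattern_leaf_pairs by (simp add: bij_betw_same_card)
qed

lemma resistance_spectrum_block:
  "resistance_spectrum (block.forest m i) =
     replicate_mset (6 * m) 1 + replicate_mset (6 * m) 2 +
     replicate_mset ((9 * m choose 2) - 12 * m) \<infinity>"
  by (simp add: block.resistance_spectrum_forest card_leaves_block card_leaf_pairs_block)

section \<open>Telling the unions apart\<close>

definition isolated_verts :: "('a, 'b) pre_digraph \<Rightarrow> 'a set" where
  "isolated_verts G = {v \<in> verts G. out_degree G v = 0}"

lemma card_isolated_verts_iso:
  assumes "wf_digraph G" "digraph_iso G H"
  shows "card (isolated_verts G) = card (isolated_verts H)"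
proof -
  obtain f where f: "pre_digraph.digraph_isomorphism G f" and H: "H = app_iso f G"
    using assms(2) by (auto simp: digraph_iso_def)
  have "isolated_verts H = iso_verts f ` isolated_verts G"
    by (auto simp: isolated_verts_def H verts_app_iso wf_digraph.out_degree_app_iso_eq[OF assms(1) f])
  moreover have "inj_on (iso_verts f) (isolated_verts G)"
    using f by (auto simp: pre_digraph.digraph_isomorphism_def isolated_verts_def intro: inj_on_subset)
  ultimately show ?thesis
    by (simp add: card_image)
qed

text \<open>
  The only star without leaves is the last one in each block of the first kind, centred at vertex
  \<open>8\<close> of the block: every other centre is joined to the vertex that follows it.
\<close>

lemma isolated_verts_block:
  assumes "i \<le> m"
  shows "isolated_verts (with_proj (block.forest m i)) = (\<lambda>q. 9 * q + 8) ` {..<i}"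
proof -
  interpret G: pair_graph "block.forest m i" by (rule block.pair_graph_forest)
  have out_degree_0: "out_degree (with_proj (block.forest m i)) v = 0 \<longleftrightarrow>
      (\<forall>w. (v, w) \<notin> parcs (block.forest m i))" for v
  proof -
    have "finite (out_arcs (with_proj (block.forest m i)) v)"
      by (rule finite_subset[OF _ G.pair_finite_arcs]) (auto simp: out_arcs_def)
    then show ?thesis
      by (auto simp: out_degree_def out_arcs_def)
  qed
  have next_leaf: "block_pattern b ! (r + 1) = r \<and> r + 1 < 9"
    if "block_pattern b ! r = r" "r < 9" "\<not> (b \<and> r = 8)" for b r
  proof -
    have "\<forall>r<9. block_pattern b ! r = r \<longrightarrow> \<not> (b \<and> r = 8) \<longrightarrow>
        block_pattern b ! (r + 1) = r \<and> r + 1 < 9"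
      unfolding all_less_9 by (simp add: block_pattern_def)
    then show ?thesis
      using that by blast
  qed
  have only_8: "r = 8" if "block_pattern True ! r = 8" "r < 9" for r
  proof -
    have "\<forall>r<9. block_pattern True ! r = 8 \<longrightarrow> r = 8"
      unfolding all_less_9 by (simp add: block_pattern_def)
    then show ?thesis
      using that by blast
  qed
  have "v \<in> (\<lambda>q. 9 * q + 8) ` {..<i}"
    if v: "v < 9 * m" and isolated: "\<And>w. (v, w) \<notin> parcs (block.forest m i)" for v
  proof (rule ccontr)
    assume notin: "v \<notin> (\<lambda>q. 9 * q + 8) ` {..<i}"
    have not_8: "\<not> (v div 9 < i \<and> v mod 9 = 8)"
    proof
      assume *: "v div 9 < i \<and> v mod 9 = 8"
      then have "v = 9 * (v div 9) + 8"
        using mult_div_mod_eq[of 9 v] by simp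
      then show False
        using notin * by blast
    qed
    have "block_centre i v = v"
      using isolated[of "block_centre i v"] v block.centre_in_V[of v m i]
      by (auto simp: block.mem_parcs_forest)
    then have "block_pattern (v div 9 < i) ! (v mod 9) = v mod 9"
      by (metis block_centre_mod)
    from next_leaf[OF this _ not_8]
    have leaf: "block_pattern (v div 9 < i) ! (v mod 9 + 1) = v mod 9" "v mod 9 + 1 < 9"
      by simp_all
    then have w: "(v + 1) div 9 = v div 9" "(v + 1) mod 9 = v mod 9 + 1"
      by (simp_all add: div_Suc mod_Suc)
    then have "block_centre i (v + 1) = v"
      using leaf(1) by (simp only: block_centre_eq_iff)
    moreover have "v + 1 < 9 * m"
      using v w(1) div_less_iff_less_mult[of 9 "v + 1" m] div_less_iff_less_mult[of 9 v m]
      by (simp add: mult.commute)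
    ultimately have "(v, v + 1) \<in> parcs (block.forest m i)"
      using v by (simp add: block.mem_parcs_forest)
    then show False
      using isolated by blast
  qed
  moreover have "(9 * q + 8, w) \<notin> parcs (block.forest m i)" if "q < i" for q w
  proof
    assume "(9 * q + 8, w) \<in> parcs (block.forest m i)"
    moreover have "block_centre i (9 * q + 8) = 9 * q + 8"
      using that by (simp add: block_centre_def block_pattern_def)
    ultimately have w: "block_centre i w = 9 * q + 8" "w \<noteq> 9 * q + 8"
      by (auto simp: block.mem_parcs_forest)
    have "w div 9 = q" and "block_pattern (w div 9 < i) ! (w mod 9) = 8"
      using w(1) by (auto simp: block_centre_eq_iff)
    then show False
      using that only_8[of "w mod 9"] w(2) mult_div_mod_eq[of 9 w] by simp
  qed
  ultimately show ?thesis
    using assms by (auto simp: isolated_verts_def out_degree_0)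
qed

theorem theorem2p10:
  fixes k :: nat
  assumes "k \<ge> 1"
  shows "\<exists>S :: nat pair_pre_digraph set.
           finite S \<and> card S \<ge> 2 ^ k \<and>
           (\<forall>G\<in>S. pair_graph G) \<and>
           pairwise (\<lambda>G H. \<not> digraph_iso (with_proj G) (with_proj H)) S \<and>
           (\<forall>G\<in>S. \<forall>H\<in>S. resistance_spectrum G = resistance_spectrum H)"
proof (intro exI conjI)
  define m :: nat where "m = 2 ^ k"
  define F where "F i = block.forest m i" for i
  have iso: "card (isolated_verts (with_proj (F i))) = i" if "i \<in> {..m}" for i
    using that by (simp add: F_def isolated_verts_block card_image inj_on_def)
  have wf: "wf_digraph (with_proj (F i))" for i
    using block.pair_graph_forest[of m i]
    by (simp add: F_def wf_digraph_wp_iff pair_graph_def pair_digraph_def pair_fin_digraph_def)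
  have "inj_on F {..m}"
    using iso by (metis inj_onI)
  then show "card (F ` {..m}) \<ge> 2 ^ k"
    by (simp add: card_image m_def)
  show "finite (F ` {..m})"
    by simp
  show "\<forall>G\<in>F ` {..m}. pair_graph G"
    using block.pair_graph_forest by (simp add: F_def)
  show "pairwise (\<lambda>G H. \<not> digraph_iso (with_proj G) (with_proj H)) (F ` {..m})"
    using iso card_isolated_verts_iso wf unfolding pairwise_def by (metis imageE)
  show "\<forall>G\<in>F ` {..m}. \<forall>H\<in>F ` {..m}. resistance_spectrum G = resistance_spectrum H"
    by (simp add: F_def resistance_spectrum_block)
qed

end
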